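(* For any positive integers $n$, $d$ and $r$, if $f_{n,d}$ is uniformly chosen from $\mathrm{Hom}(P_{n,d},0)$, then $$\mathbb{P}\big(|\mathrm{Rng}(f_{n,d})| \ge 3+r\big) \le \binom{n}{r} 2^{-dr} \quad\text{and}\quad \mathbb{P}\big(|\mathrm{Rng}(f_{n,d})| < 3\big) \le 2^{1-n/2}.$$ Thus, if $d(n)$ is a sequence of positive integers with $d(n)-\log_2 n \to \infty$ as $n\to\infty$, then $\mathbb{P}\big(|\mathrm{Rng}(f_{n,d(n)})| = 3\big) \to 1$ as $n \to \infty$.
   Context: For $n,d\ge 1$, $P_{n,d}$ is the graph with vertex set $\{0,1,\dots,n\}$ in which $i,j$ are adjacent iff $|i-j|\in\{1,3,\dots,2d+1\}$. $\mathrm{Hom}(P_{n,d},0)$ is the finite set of functions $f\colon\{0,\dots,n\}\to\mathbb{Z}$ with $f(0)=0$ and $|f(i)-f(j)|=1$ whenever $i,j$ are adjacent in $P_{n,d}$. $\mathrm{Rng}(f)$ denotes the set of values taken by $f$, and $|\cdot|$ is cardinality. *)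

theory Defs
  imports "HOL-Probability.Probability"
begin

text \<open>The graph has vertex set \<open>{0..n}\<close>. The distance is taken in \<open>int\<close>, since subtraction on
  \<open>nat\<close> truncates.\<close>

definition P_adj :: "nat \<Rightarrow> nat \<Rightarrow> nat \<Rightarrow> nat \<Rightarrow> bool" where
  "P_adj n d i j \<longleftrightarrow> i \<in> {0..n} \<and> j \<in> {0..n} \<and> \<bar>int i - int j\<bar> \<in> {2 * int k + 1 |k. k \<le> d}"

text \<open>Functions on \<open>{0..n}\<close> are extensional functions (\<open>undefined\<close> outside \<open>{0..n}\<close>), so that each
  of them is counted exactly once.\<close>

definition Hom_P :: "nat \<Rightarrow> nat \<Rightarrow> (nat \<Rightarrow> int) set" where
  "Hom_P n d = {f \<in> {0..n} \<rightarrow>\<^sub>E UNIV. f 0 = 0 \<and> (\<forall>i j. P_adj n d i j \<longrightarrow> \<bar>f i - f j\<bar> = 1)}"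

definition Rng :: "nat \<Rightarrow> (nat \<Rightarrow> int) \<Rightarrow> int set" where
  "Rng n f = f ` {0..n}"

text \<open>\<open>pmf_of_set\<close> is the uniform distribution only on finite nonempty sets; this holds here
  by \<open>finite_Hom_P\<close> and \<open>Hom_P_nonempty\<close>.\<close>

definition unif_Hom_P :: "nat \<Rightarrow> nat \<Rightarrow> (nat \<Rightarrow> int) pmf" where
  "unif_Hom_P n d = pmf_of_set (Hom_P n d)"

lemma finite_Hom_P: "finite (Hom_P n d)"
proof (rule finite_subset)
  show "Hom_P n d \<subseteq> {0..n} \<rightarrow>\<^sub>E {- int n..int n}"
  proof
    fix f assume f: "f \<in> Hom_P n d"
    have adj: "P_adj n d i (Suc i)" if "Suc i \<le> n" for i
      unfolding P_adj_def using that by (auto intro!: exI[of _ 0])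
    have bound: "\<bar>f i\<bar> \<le> int i" if "i \<le> n" for i
      using that
    proof (induction i)
      case 0
      then show ?case using f by (simp add: Hom_P_def)
    next
      case (Suc i)
      have "\<bar>f i - f (Suc i)\<bar> = 1"
        using f adj[OF Suc.prems] unfolding Hom_P_def by blast
      then show ?case using Suc by linarith
    qed
    have "f i \<in> {- int n..int n}" if "i \<in> {0..n}" for i
      using bound[of i] that by auto
    then show "f \<in> {0..n} \<rightarrow>\<^sub>E {- int n..int n}"
      using f by (auto simp: Hom_P_def PiE_iff)
  qed
  show "finite ({0..n} \<rightarrow>\<^sub>E {- int n..int n})"
    by (intro finite_PiE) auto
qed

lemma Hom_P_nonempty: "Hom_P n d \<noteq> {}"
proof -
  have "restrict (\<lambda>i. int (i mod 2)) {0..n} \<in> Hom_P n d"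
  proof -
    have "\<bar>int (i mod 2) - int (j mod 2)\<bar> = 1" if "\<bar>int i - int j\<bar> = 2 * int k + 1" for i j k
      using that by presburger
    then show ?thesis
      unfolding Hom_P_def P_adj_def by auto
  qed
  then show ?thesis by blast
qed

end

(* Record f by the set of its turns, the t >= 2 with f t ~= f (t - 2): together with the sign of f 1
   it determines f, and a set of times in {2..n} arises in this way iff no two of its elements are at
   an odd distance smaller than 2 d. If f takes a new value at t after at least three earlier values,
   then on the preceding 2 d + 1 vertices f alternates between two values, so t is a turn and no turn
   lies strictly within distance 2 d before t. Such a forced gap costs a factor 2^d: the turn at t can
   be traded injectively for d free choices, without touching what lies before the gap. Doing this for
   r record times, from the last to the first, and summing over the sets of r times in {1..n} bounds
   the number of f with at least 3 + r values. If f has fewer than three values it has no turns, while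
   every set of even times is a possible set of turns. *)

theory Submission
  imports Defs "HOL-Real_Asymp.Real_Asymp"
begin

section \<open>Encoding homomorphisms by sets of turns\<close>

text \<open>The edge condition alone: without extensionality and \<open>f 0 = 0\<close> it also
  applies to unrestricted functions such as \<open>hom_of_turns \<sigma> S\<close> and pointwise
  negatives.\<close>

definition is_hom :: "nat \<Rightarrow> nat \<Rightarrow> (nat \<Rightarrow> int) \<Rightarrow> bool" where
  "is_hom n d f \<longleftrightarrow> (\<forall>i k. k \<le> d \<longrightarrow> i + 2 * k + 1 \<le> n \<longrightarrow> \<bar>f (i + 2 * k + 1) - f i\<bar> = 1)"

lemma is_homD:
  assumes "is_hom n d f" "i < j" "j \<le> n" "j \<le> i + 2 * d + 1" "odd (j - i)"
  shows "\<bar>f j - f i\<bar> = 1"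
proof -
  obtain k where "j - i = 2 * k + 1" using assms(5) by (rule oddE)
  then have "j = i + 2 * k + 1" "k \<le> d" using assms by linarith+
  then show ?thesis using assms unfolding is_hom_def by blast
qed

lemma is_homD':
  assumes "is_hom n d f" "i \<le> n" "j \<le> n" "j \<le> i + 2 * d + 1" "i \<le> j + 2 * d + 1" "odd (i + j)"
  shows "\<bar>f j - f i\<bar> = 1"
proof -
  have "i \<noteq> j" using assms(6) by auto
  then consider "i < j" | "j < i" by linarith
  then show ?thesis
  proof cases
    case 1
    then have "odd (j - i)" using assms(6) by presburger
    then show ?thesis using is_homD[OF assms(1), of i j] 1 assms by blast
  next
    case 2
    then have "odd (i - j)" using assms(6) by presburger
    then have "\<bar>f i - f j\<bar> = 1" using is_homD[OF assms(1), of j i] 2 assms by blast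
    then show ?thesis by (simp add: abs_minus_commute)
  qed
qed

lemma is_hom_step: "is_hom n d f \<Longrightarrow> Suc t \<le> n \<Longrightarrow> \<bar>f (Suc t) - f t\<bar> = 1"
  by (rule is_homD) auto

lemma is_hom_uminus: "is_hom n d f \<Longrightarrow> is_hom n d (\<lambda>i. - f i)"
  unfolding is_hom_def by (simp add: abs_minus_commute)

lemma Hom_P_iff: "f \<in> Hom_P n d \<longleftrightarrow> f \<in> extensional {0..n} \<and> f 0 = 0 \<and> is_hom n d f"
proof -
  have "(\<forall>i j. P_adj n d i j \<longrightarrow> \<bar>f i - f j\<bar> = 1) \<longleftrightarrow> is_hom n d f"
  proof
    assume *: "\<forall>i j. P_adj n d i j \<longrightarrow> \<bar>f i - f j\<bar> = 1"
    show "is_hom n d f"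
      unfolding is_hom_def
    proof (intro allI impI)
      fix i k assume "k \<le> d" "i + 2 * k + 1 \<le> n"
      then have "P_adj n d (i + 2 * k + 1) i"
        unfolding P_adj_def by auto
      then show "\<bar>f (i + 2 * k + 1) - f i\<bar> = 1" using * by blast
    qed
  next
    assume h: "is_hom n d f"
    show "\<forall>i j. P_adj n d i j \<longrightarrow> \<bar>f i - f j\<bar> = 1"
    proof (intro allI impI)
      fix i j assume "P_adj n d i j"
      then obtain k where k: "\<bar>int i - int j\<bar> = 2 * int k + 1" "k \<le> d" and ij: "i \<le> n" "j \<le> n"
        unfolding P_adj_def by auto
      have "odd (j + i)" using k by presburger
      moreover have "j \<le> i + 2 * d + 1" "i \<le> j + 2 * d + 1" using k by linarith+
      ultimately show "\<bar>f i - f j\<bar> = 1"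
        using is_homD'[OF h] ij by blast
    qed
  qed
  then show ?thesis by (auto simp: Hom_P_def PiE_def)
qed

text \<open>As a homomorphism moves by unit steps, these are the times at which it keeps its
  direction instead of stepping back; between them it zigzags.\<close>

definition turns :: "nat \<Rightarrow> (nat \<Rightarrow> int) \<Rightarrow> nat set" where
  "turns n f = {t \<in> {2..n}. f t \<noteq> f (t - 2)}"

text \<open>The bound \<open>2 * d\<close> is the one that keeps \<open>u - 2\<close> and
  \<open>t\<close> adjacent: an odd \<open>t - u\<close> below it makes their distance at most
  \<open>2 * d + 1\<close>.\<close>

definition spread_sets :: "nat \<Rightarrow> nat \<Rightarrow> nat set set" where
  "spread_sets n d =
    {S. S \<subseteq> {2..n} \<and> (\<forall>u\<in>S. \<forall>t\<in>S. u < t \<longrightarrow> t < u + 2 * d \<longrightarrow> even (t - u))}"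

lemma finite_spread_sets: "finite (spread_sets n d)"
  by (rule finite_subset[of _ "Pow {2..n}"]) (auto simp: spread_sets_def)

text \<open>At a forbidden distance both \<open>u\<close> and \<open>u - 2\<close> are adjacent to
  both \<open>t\<close> and \<open>t - 2\<close>. An integer at distance 1 from the different values
  \<open>f u\<close> and \<open>f (u - 2)\<close> is their midpoint, so
  \<open>f t = f (t - 2)\<close>.\<close>

lemma turns_spread:
  assumes "is_hom n d f"
  shows "turns n f \<in> spread_sets n d"
  unfolding spread_sets_def
proof (intro CollectI conjI ballI impI)
  show "turns n f \<subseteq> {2..n}" by (auto simp: turns_def)
next
  fix u t assume ut: "u \<in> turns n f" "t \<in> turns n f" "u < t" "t < u + 2 * d"
  show "even (t - u)"
  proof (rule ccontr)
    assume odd: "odd (t - u)"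
    have b: "2 \<le> u" "u \<le> n" "2 \<le> t" "t \<le> n" "f u \<noteq> f (u - 2)" "f t \<noteq> f (t - 2)"
      using ut by (auto simp: turns_def)
    obtain u' where u': "u = u' + 2" using b by (metis add.commute le_Suc_ex)
    obtain t' where t': "t = t' + 2" using b by (metis add.commute le_Suc_ex)
    have par: "odd (u' + t')" using odd ut unfolding u' t' by presburger
    have "\<bar>f (t' + 2) - f (u' + 2)\<bar> = 1" "\<bar>f (t' + 2) - f u'\<bar> = 1"
      "\<bar>f t' - f (u' + 2)\<bar> = 1" "\<bar>f t' - f u'\<bar> = 1"
      using par ut b unfolding u' t' by (auto intro!: is_homD'[OF assms])
    then show False using b unfolding u' t' by simp
  qed
qed

lemma hom_recursion:
  assumes "is_hom n d f" "Suc (Suc t) \<le> n"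
  shows "f (Suc (Suc t)) = (if Suc (Suc t) \<in> turns n f then 2 * f (Suc t) - f t else f t)"
proof -
  have "\<bar>f (Suc (Suc t)) - f (Suc t)\<bar> = 1" "\<bar>f (Suc t) - f t\<bar> = 1"
    using is_hom_step[OF assms(1)] assms(2) by auto
  then show ?thesis using assms(2) by (auto simp: turns_def)
qed

section \<open>Rebuilding a homomorphism from its turns\<close>

fun hom_of_turns :: "int \<Rightarrow> nat set \<Rightarrow> nat \<Rightarrow> int" where
  "hom_of_turns \<sigma> S 0 = 0"
| "hom_of_turns \<sigma> S (Suc 0) = \<sigma>"
| "hom_of_turns \<sigma> S (Suc (Suc t)) =
    (if Suc (Suc t) \<in> S then 2 * hom_of_turns \<sigma> S (Suc t) - hom_of_turns \<sigma> S t
     else hom_of_turns \<sigma> S t)"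

lemma hom_of_turns_step:
  assumes "\<bar>\<sigma>\<bar> = 1"
  shows "\<bar>hom_of_turns \<sigma> S (Suc t) - hom_of_turns \<sigma> S t\<bar> = 1"
  by (induction t) (use assms in auto)

lemma hom_of_turns_const:
  assumes "\<And>j. j < k \<Longrightarrow> i + 2 * j + 2 \<notin> S"
  shows "hom_of_turns \<sigma> S (i + 2 * k) = hom_of_turns \<sigma> S i"
  using assms by (induction k) auto

text \<open>Induction on \<open>k\<close>: if \<open>i + 2 * k + 3\<close> is not in
  \<open>S\<close>, the value at the far end does not change. If it is, the times
  \<open>i + 2 * j + 2\<close> with \<open>j \<le> k\<close> are excluded from \<open>S\<close>, so
  the value at \<open>i + 2 * k + 2\<close> equals that at \<open>i\<close> and the long edge
  becomes a unit step.\<close>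

lemma is_hom_hom_of_turns:
  assumes \<sigma>: "\<bar>\<sigma>\<bar> = 1" and S: "S \<in> spread_sets n d"
  shows "is_hom n d (hom_of_turns \<sigma> S)"
  unfolding is_hom_def
proof (intro allI impI)
  fix i k assume "k \<le> d" "i + 2 * k + 1 \<le> n"
  then show "\<bar>hom_of_turns \<sigma> S (i + 2 * k + 1) - hom_of_turns \<sigma> S i\<bar> = 1"
  proof (induction k)
    case 0
    then show ?case using hom_of_turns_step[OF \<sigma>] by simp
  next
    case (Suc k)
    show ?case
    proof (cases "Suc (Suc (i + 2 * k + 1)) \<in> S")
      case False
      then show ?thesis using Suc by simp
    next
      case True
      have "hom_of_turns \<sigma> S (i + 2 * Suc k) = hom_of_turns \<sigma> S i"
      proof (rule hom_of_turns_const)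
        fix j assume j: "j < Suc k"
        show "i + 2 * j + 2 \<notin> S"
        proof
          assume "i + 2 * j + 2 \<in> S"
          moreover have "i + 2 * j + 2 < Suc (Suc (i + 2 * k + 1))" using j by simp
          moreover have "Suc (Suc (i + 2 * k + 1)) < i + 2 * j + 2 + 2 * d" using Suc.prems by simp
          ultimately have "even (Suc (Suc (i + 2 * k + 1)) - (i + 2 * j + 2))"
            using S True unfolding spread_sets_def by blast
          then show False using j by presburger
        qed
      qed
      then show ?thesis using hom_of_turns_step[OF \<sigma>, of S "i + 2 * Suc k"] by simp
    qed
  qed
qed

lemma is_hom_cong:
  assumes "\<And>i. i \<le> n \<Longrightarrow> f i = g i"
  shows "is_hom n d f \<longleftrightarrow> is_hom n d g"
  unfolding is_hom_def using assms by auto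

lemma turns_cong:
  assumes "\<And>i. i \<le> n \<Longrightarrow> f i = g i"
  shows "turns n f = turns n g"
  unfolding turns_def using assms by auto

lemma turns_hom_of_turns:
  assumes "\<bar>\<sigma>\<bar> = 1" "S \<subseteq> {2..n}"
  shows "turns n (hom_of_turns \<sigma> S) = S"
proof (rule set_eqI)
  fix t
  show "t \<in> turns n (hom_of_turns \<sigma> S) \<longleftrightarrow> t \<in> S"
  proof (cases "2 \<le> t")
    case True
    then obtain t' where t': "t = Suc (Suc t')" by (metis add_2_eq_Suc le_Suc_ex)
    have "\<bar>hom_of_turns \<sigma> S (Suc t') - hom_of_turns \<sigma> S t'\<bar> = 1"
      using hom_of_turns_step assms by blast
    then show ?thesis unfolding t' using assms(2) by (auto simp: turns_def)
  next
    case False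
    then show ?thesis using assms(2) by (auto simp: turns_def)
  qed
qed

text \<open>Injective since \<open>f 0\<close>, \<open>f 1\<close> and the turns drive the recursion
  \<open>hom_recursion\<close>; the inverse is \<open>hom_of_turns\<close>, restricted to
  \<open>{0..n}\<close>.\<close>

lemma bij_betw_turns:
  assumes "n \<ge> 1"
  shows "bij_betw (\<lambda>f. (f 1, turns n f)) (Hom_P n d) ({1, -1} \<times> spread_sets n d)"
  unfolding bij_betw_def
proof (intro conjI subset_antisym)
  show "inj_on (\<lambda>f. (f 1, turns n f)) (Hom_P n d)"
  proof (rule inj_onI)
    fix f g assume f: "f \<in> Hom_P n d" and g: "g \<in> Hom_P n d" and eq: "(f 1, turns n f) = (g 1, turns n g)"
    have fh: "is_hom n d f" "f 0 = 0" and gh: "is_hom n d g" "g 0 = 0" using f g by (auto simp: Hom_P_iff)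
    have "t \<le> n \<longrightarrow> f t = g t" for t
    proof (induction t rule: less_induct)
      case (less t)
      consider "t = 0" | "t = 1" | t' where "t = Suc (Suc t')"
        by (metis One_nat_def not0_implies_Suc)
      then show ?case
      proof cases
        case 3
        then show ?thesis using less.IH[of t'] less.IH[of "Suc t'"] eq
          hom_recursion[OF fh(1), of t'] hom_recursion[OF gh(1), of t'] by auto
      qed (use fh gh eq in auto)
    qed
    then show "f = g" using f g by (intro extensionalityI[of _ "{0..n}"]) (auto simp: Hom_P_iff)
  qed
next
  show "(\<lambda>f. (f 1, turns n f)) ` Hom_P n d \<subseteq> {1, -1} \<times> spread_sets n d"
  proof (rule image_subsetI)
    fix f assume "f \<in> Hom_P n d"
    then have f: "is_hom n d f" "f 0 = 0" by (auto simp: Hom_P_iff)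
    have "\<bar>f 1\<bar> = 1" using is_hom_step[OF f(1), of 0] assms f(2) by auto
    then show "(f 1, turns n f) \<in> {1, -1} \<times> spread_sets n d" using turns_spread[OF f(1)] by auto
  qed
next
  show "{1, -1} \<times> spread_sets n d \<subseteq> (\<lambda>f. (f 1, turns n f)) ` Hom_P n d"
  proof (rule subsetI)
    fix x :: "int \<times> nat set" assume x: "x \<in> {1, -1} \<times> spread_sets n d"
    obtain \<sigma> S where x': "x = (\<sigma>, S)" by force
    have \<sigma>: "\<bar>\<sigma>\<bar> = 1" and S: "S \<in> spread_sets n d" using x x' by auto
    define f where "f = restrict (hom_of_turns \<sigma> S) {0..n}"
    have fe: "\<And>i. i \<le> n \<Longrightarrow> f i = hom_of_turns \<sigma> S i" by (simp add: f_def)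
    have "f \<in> Hom_P n d"
      using is_hom_hom_of_turns[OF \<sigma> S] is_hom_cong[of n f "hom_of_turns \<sigma> S" d] fe
      by (auto simp: Hom_P_iff f_def)
    moreover have "turns n f = S"
      using turns_cong[of n f "hom_of_turns \<sigma> S"] fe turns_hom_of_turns[OF \<sigma>, of S n] S
      by (auto simp: spread_sets_def)
    moreover have "f 1 = \<sigma>" using fe[of 1] assms by simp
    ultimately show "x \<in> (\<lambda>f. (f 1, turns n f)) ` Hom_P n d" unfolding x' by blast
  qed
qed

text \<open>Reduces counting homomorphisms to counting sets; the factor 2 is the sign of
  \<open>f 1\<close>.\<close>

lemma card_Hom_P_turns:
  assumes "n \<ge> 1" "A \<subseteq> spread_sets n d"
  shows "card {f \<in> Hom_P n d. turns n f \<in> A} = 2 * card A"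
proof -
  have "bij_betw (\<lambda>f. (f 1, turns n f)) {f \<in> Hom_P n d. turns n f \<in> A} ({1, -1} \<times> A)"
  proof (rule bij_betw_subset[OF bij_betw_turns[OF assms(1), of d]])
    show "(\<lambda>f. (f 1, turns n f)) ` {f \<in> Hom_P n d. turns n f \<in> A} = {1, -1} \<times> A" (is "?F ` ?H = _")
    proof
      show "?F ` ?H \<subseteq> {1, -1} \<times> A"
        using bij_betw_apply[OF bij_betw_turns[OF assms(1), of d]] by auto
      show "{1, -1} \<times> A \<subseteq> ?F ` ?H"
      proof
        fix x :: "int \<times> nat set" assume x: "x \<in> {1, -1} \<times> A"
        then have "x \<in> ?F ` Hom_P n d"
          using assms(2) bij_betw_imp_surj_on[OF bij_betw_turns[OF assms(1), of d]] by auto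
        then show "x \<in> ?F ` ?H" using x by auto
      qed
    qed
  qed auto
  then have "card {f \<in> Hom_P n d. turns n f \<in> A} = card ({1, -1 :: int} \<times> A)"
    by (rule bij_betw_same_card)
  then show ?thesis by (simp add: card_cartesian_product)
qed

lemma card_Hom_P:
  assumes n: "n \<ge> 1"
  shows "card (Hom_P n d) = 2 * card (spread_sets n d)"
proof -
  have "{f \<in> Hom_P n d. turns n f \<in> spread_sets n d} = Hom_P n d"
    using turns_spread by (auto simp: Hom_P_iff)
  then show ?thesis using card_Hom_P_turns[OF n, of "spread_sets n d" d] by simp
qed

section \<open>Turns after a gap\<close>

text \<open>In the application \<open>T\<close> consists of times at which \<open>f\<close> takes a
  new value.\<close>

definition gap_sets :: "nat \<Rightarrow> nat \<Rightarrow> nat set \<Rightarrow> nat set set" where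
  "gap_sets n d T =
    {S \<in> spread_sets n d. T \<subseteq> S \<and> (\<forall>t\<in>T. \<forall>u\<in>S. u < t \<longrightarrow> u + 2 * d \<le> t)}"

text \<open>Given \<open>t \<in> S\<close> after a gap, \<open>refill\<close> overwrites \<open>t\<close> by an arbitrary choice among the \<open>d\<close>
  positions \<open>t - e, t - e - 2, \<dots>\<close>. The shift \<open>e\<close> gives them the parity of the last element of \<open>S\<close>
  below the gap, and the part of \<open>S\<close> above \<open>t\<close> moves along. Since the part below the gap is
  unchanged, \<open>e\<close> can be read off from the result, so nothing is lost.\<close>

definition shift :: "nat \<Rightarrow> nat set \<Rightarrow> nat" where
  "shift t L = (if L \<noteq> {} \<and> odd (t - Max L) then 1 else 0)"

definition refill :: "nat \<Rightarrow> nat set \<times> nat set \<Rightarrow> nat set" where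
  "refill t = (\<lambda>(S, B). let e = shift t {u \<in> S. u < t} in
     {u \<in> S. u < t} \<union> (\<lambda>j. t - e - 2 * j) ` B \<union> (\<lambda>u. u - e) ` {u \<in> S. t < u})"

context
  fixes n d t :: nat and T S B L :: "nat set" and e :: nat
  assumes S: "S \<in> gap_sets n d T" and t: "t \<in> T" "\<And>t'. t' \<in> T \<Longrightarrow> t' \<le> t"
    and td: "2 * d \<le> t" and d: "1 \<le> d" and B: "B \<subseteq> {..<d}"
  defines "L \<equiv> {u \<in> S. u < t}"
  defines "e \<equiv> shift t {u \<in> S. u < t}"
begin

lemma refill_unfold: 
  "refill t (S, B) = L \<union> (\<lambda>j. t - e - 2 * j) ` B \<union> (\<lambda>u. u - e) ` {u \<in> S. t < u}"
  by (simp add: refill_def L_def e_def Let_def)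

lemma S_props: "S \<subseteq> {2..n}" "t \<in> S" 
    "\<And>u v. u \<in> S \<Longrightarrow> v \<in> S \<Longrightarrow> u < v \<Longrightarrow> v < u + 2 * d \<Longrightarrow> even (v - u)"
    "\<And>u. u \<in> S \<Longrightarrow> u < t \<Longrightarrow> u + 2 * d \<le> t"
  using S t by (auto simp: gap_sets_def spread_sets_def)

lemma finite_L: "finite L"
  unfolding L_def by simp

lemma e_le: "e \<le> 1"
  by (simp add: e_def shift_def)

text \<open>The gap has at least the even length \<open>2 * d\<close>; if \<open>e = 1\<close>, the
  distance from \<open>Max L\<close> to \<open>t\<close> is odd and hence larger.\<close>

lemma L_le: "u \<in> L \<Longrightarrow> u + 2 * d + e \<le> t"
proof -
  assume u: "u \<in> L"
  define m where "m = Max L"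
  have "m \<in> L" using u finite_L unfolding m_def by (intro Max_in) auto
  then have m: "m + 2 * d \<le> t" using S_props(4) by (auto simp: L_def)
  have "odd (t - m)" if "e = 1"
    using that unfolding e_def shift_def L_def[symmetric] m_def by (auto split: if_splits)
  then have "m + 2 * d \<noteq> t" if "e = 1" using that by auto
  then have "m + 2 * d + e \<le> t" using m e_le by (cases "e = 1") auto
  moreover have "u \<le> m" using u finite_L by (simp add: m_def)
  ultimately show ?thesis by linarith
qed

text \<open>The inserted positions have the parity of \<open>t - e\<close>, hence of
  \<open>Max L\<close>. An element of \<open>L\<close> of the other parity is at least
  \<open>2 * d\<close> below \<open>Max L\<close>, which is too far from those positions to conflict
  with them.\<close>

lemma L_parity:
  assumes u: "u \<in> L"
  shows "even (t - e - u) \<or> u + 4 * d + e \<le> t"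
proof -
  define m where "m = Max L"
  have mL: "m \<in> L" using u finite_L unfolding m_def by (intro Max_in) auto
  have um: "u \<le> m" using u finite_L by (simp add: m_def)
  have b: "m + 2 * d + e \<le> t" using L_le[OF mL] .
  have "even (t - e - m)"
    using mL b unfolding e_def shift_def L_def[symmetric] m_def by (auto split: if_splits)
  then have *: "even (t - e - u) \<longleftrightarrow> even (m - u)"
    using b um by auto
  show ?thesis
  proof (cases "even (m - u)")
    case False
    then have "u \<noteq> m" by auto
    then have "u + 2 * d \<le> m"
      using S_props(3)[of u m] u mL um False unfolding L_def by force
    then show ?thesis using b by linarith
  qed (use * in simp)
qed

lemma e_1: "e = 1 \<Longrightarrow> 2 * d + 3 \<le> t"
proof -
  assume e1: "e = 1"
  then obtain u where "u \<in> L" unfolding e_def shift_def L_def by (auto split: if_splits)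
  then show ?thesis using L_le[of u] S_props(1) e1 by (auto simp: L_def)
qed

lemma refill_mid:
  assumes "j \<in> B"
  shows "t = t - e - 2 * j + 2 * j + e" "2 \<le> t - e - 2 * j" "t < t - e - 2 * j + 2 * d"
proof -
  have "j < d" using assms B by auto
  then show "t = t - e - 2 * j + 2 * j + e" "2 \<le> t - e - 2 * j" "t < t - e - 2 * j + 2 * d"
    using e_1 e_le td by (cases "e = 1"; auto)+
qed

text \<open>The three pieces occupy disjoint ranges: up to \<open>t - 2 * d - e\<close>, then above
  \<open>t - 2 * d\<close> and up to \<open>t - e\<close>, then beyond \<open>t - e\<close>. This
  makes the result decodable.\<close>

lemma refill_cases:
  assumes "x \<in> refill t (S, B)"
  obtains (L) "x \<in> L" "x + 2 * d + e \<le> t"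
  | (mid) j where "j \<in> B" "t = x + 2 * j + e" "2 \<le> x" "t < x + 2 * d"
  | (right) u where "u \<in> S" "t < u" "u = x + e"
proof -
  consider "x \<in> L" | j where "j \<in> B" "x = t - e - 2 * j" | u where "u \<in> S" "t < u" "x = u - e"
    using assms unfolding refill_unfold by blast
  then show thesis
  proof cases
    case 1
    then show ?thesis using L L_le by blast
  next
    case 2
    then show ?thesis using mid refill_mid[of j] by blast
  next
    case 3
    then have "u = x + e" using e_le by auto
    then show ?thesis using right 3 by blast
  qed
qed

text \<open>Recovers \<open>L\<close>, and with it \<open>e\<close>, from the result and
  \<open>t\<close> alone.\<close>

lemma refill_low: "{u \<in> refill t (S, B). u + 2 * d \<le> t} = L"
proof (intro subset_antisym subsetI)
  fix x assume "x \<in> {u \<in> refill t (S, B). u + 2 * d \<le> t}"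
  then have x: "x \<in> refill t (S, B)" "x + 2 * d \<le> t" by simp_all
  from x(1) show "x \<in> L"
    by (cases rule: refill_cases) (use x(2) d e_le in linarith)+
next
  fix x assume "x \<in> L"
  then show "x \<in> {u \<in> refill t (S, B). u + 2 * d \<le> t}"
    using L_le[of x] by (auto simp: refill_unfold)
qed

lemma refill_mid_iff:
  assumes j: "j < d"
  shows "t - e - 2 * j \<in> refill t (S, B) \<longleftrightarrow> j \<in> B"
proof
  define x where "x = t - e - 2 * j"
  have tx: "t = x + 2 * j + e" using j e_1 e_le td unfolding x_def by (cases "e = 1") auto
  assume "t - e - 2 * j \<in> refill t (S, B)"
  then have "x \<in> refill t (S, B)" by (simp add: x_def)
  then show "j \<in> B"
  proof (cases rule: refill_cases)
    case L
    then show ?thesis using j tx by linarith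
  next
    case (mid j')
    then have "j = j'" using tx by linarith
    then show ?thesis using mid by simp
  next
    case (right u)
    then show ?thesis using tx by linarith
  qed
qed (auto simp: refill_unfold)

lemma refill_right_iff:
  assumes u: "t < u"
  shows "u - e \<in> refill t (S, B) \<longleftrightarrow> u \<in> S"
proof
  define x where "x = u - e"
  have ux: "u = x + e" using u e_le by (simp add: x_def)
  assume "u - e \<in> refill t (S, B)"
  then have "x \<in> refill t (S, B)" by (simp add: x_def)
  then show "u \<in> S"
  proof (cases rule: refill_cases)
    case L
    then show ?thesis using u ux by linarith
  next
    case (mid j')
    then show ?thesis using u ux by linarith
  next
    case (right u')
    then show ?thesis using ux by simp
  qed
qed (use u in \<open>auto simp: refill_unfold\<close>)

text \<open>Pairs within \<open>L\<close> or within the shifted part inherit the condition from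
  \<open>S\<close>, and inserted positions differ by even numbers. \<open>L_parity\<close> handles
  \<open>L\<close> against inserted positions. The shifted part relates to an inserted position as
  it did to \<open>t\<close>, up to an even number, and is more than \<open>2 * d\<close> away from
  \<open>L\<close>.\<close>

lemma refill_spread: "refill t (S, B) \<in> spread_sets n d"
  unfolding spread_sets_def
proof (intro CollectI conjI ballI impI subsetI)
  have tn: "t \<le> n" "2 \<le> t" using S_props(1,2) by auto
  fix x assume "x \<in> refill t (S, B)"
  then show "x \<in> {2..n}"
  proof (cases rule: refill_cases)
    case L
    then show ?thesis using S_props(1) by (auto simp: L_def)
  next
    case (mid j)
    then show ?thesis using tn by simp
  next
    case (right u)
    then have "u \<le> n" using S_props(1) by auto
    then show ?thesis using right tn e_le by simp
  qed
next
  fix x y assume x: "x \<in> refill t (S, B)" and y: "y \<in> refill t (S, B)" and xy: "x < y" "y < x + 2 * d"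
  have ev: "even (v - u)" if "u \<in> S" "v \<in> S" "u < v" "v < u + 2 * d" for u v
    using S_props(3) that by blast
  show "even (y - x)"
    using x
  proof (cases rule: refill_cases)
    case L: L
    note par = L_parity[OF L(1)]
    show ?thesis using y
    proof (cases rule: refill_cases)
      case L': L
      then show ?thesis using ev xy L by (simp add: L_def)
    next
      case (mid j)
      \<comment> \<open>Since \<open>j < d\<close>, this alternative would put \<open>x\<close> more
        than \<open>2 * d\<close> below \<open>y\<close>.\<close>
      have "\<not> x + 4 * d + e \<le> t" using mid(2,4) xy(2) \<open>j \<in> B\<close> B by fastforce
      then have ev': "even (t - e - x)" using par by blast
      have "t - e - x = (y - x) + 2 * j" using mid(2) xy(1) by linarith
      then have "even ((y - x) + 2 * j)" using ev' by (simp only:)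
      then show ?thesis by (simp only: even_add even_mult_iff even_numeral simp_thms)
    next
      case (right u)
      then show ?thesis using L(2) xy(2) by linarith
    qed
  next
    case mid: (mid j)
    show ?thesis using y
    proof (cases rule: refill_cases)
      case L
      then show ?thesis using mid(4) xy(1) by linarith
    next
      case (mid j')
      then have "y - x = 2 * (j - j')" using \<open>t = x + 2 * j + e\<close> xy(1) by linarith
      then show ?thesis by simp
    next
      case (right u)
      have eq: "y - x = (u - t) + 2 * j" using right(2,3) mid(2) by linarith
      have "u < t + 2 * d" using right(3) mid(2) xy(2) by linarith
      then have "even (u - t)" using ev S_props(2) right by blast
      then show ?thesis unfolding eq by (simp only: even_add even_mult_iff even_numeral simp_thms)
    qed
  next
    case right: (right u)
    show ?thesis using y
    proof (cases rule: refill_cases)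
      case L
      then show ?thesis using right(2,3) xy(1) d by linarith
    next
      case (mid j)
      then show ?thesis using right(2,3) xy(1) by linarith
    next
      case right': (right u')
      have "u < u'" "u' < u + 2 * d" "u' - u = y - x"
        using xy right(3) right'(3) by linarith+
      then show ?thesis using ev[of u u'] right(1) right'(1) by simp
    qed
  qed
qed

text \<open>As \<open>t\<close> is the largest element of \<open>T\<close>, all other elements of
  \<open>T\<close> and their gaps lie at or below \<open>t - 2 * d\<close>, where the set is
  unchanged.\<close>

lemma refill_gap: "refill t (S, B) \<in> gap_sets n d (T - {t})"
  unfolding gap_sets_def
proof (intro CollectI conjI ballI impI)
  show "refill t (S, B) \<in> spread_sets n d" by (rule refill_spread)
next
  show "T - {t} \<subseteq> refill t (S, B)"
    using S t by (force simp: refill_unfold L_def gap_sets_def)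
next
  fix t' u assume t': "t' \<in> T - {t}" and u: "u \<in> refill t (S, B)" "u < t'"
  have "t' \<in> S" "t' < t" using S t' t(2)[of t'] by (auto simp: gap_sets_def)
  then have "t' + 2 * d \<le> t" using S_props(4) by blast
  then have "u \<in> L" using u refill_low by auto
  then show "u + 2 * d \<le> t'" using S t' u by (auto simp: gap_sets_def L_def)
qed

end

section \<open>The factor gained at each gap\<close>

text \<open>\<open>L\<close> is decoded first because it determines \<open>e\<close>; knowing
  \<open>e\<close>, one reads off \<open>B\<close> and the part above \<open>t\<close>.\<close>

lemma refill_inj:
  assumes "t \<in> T" "\<And>t'. t' \<in> T \<Longrightarrow> t' \<le> t" "2 * d \<le> t" "1 \<le> d"
  shows "inj_on (refill t) (gap_sets n d T \<times> Pow {..<d})"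
proof (rule inj_onI; clarify)
  fix S B S' B'
  assume S: "S \<in> gap_sets n d T" and S': "S' \<in> gap_sets n d T"
    and B: "B \<subseteq> {..<d}" and B': "B' \<subseteq> {..<d}"
    and eq: "refill t (S, B) = refill t (S', B')"
  note facts = S assms B and facts' = S' assms B'
  have L: "{u \<in> S. u < t} = {u \<in> S'. u < t}"
    using refill_low[OF facts] refill_low[OF facts'] eq by simp
  have "j \<in> B \<longleftrightarrow> j \<in> B'" if "j < d" for j
    using refill_mid_iff[OF facts that] refill_mid_iff[OF facts' that] eq L by simp
  then have "B = B'" using B B' by blast
  moreover have "u \<in> S \<longleftrightarrow> u \<in> S'" for u
  proof -
    have "t \<in> S" "t \<in> S'" using S S' assms(1) by (auto simp: gap_sets_def)
    moreover have "u \<in> S \<longleftrightarrow> u \<in> S'" if "t < u"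
      using refill_right_iff[OF facts that] refill_right_iff[OF facts' that] eq L by simp
    moreover have "u \<in> S \<longleftrightarrow> u \<in> S'" if "u < t" using L that by blast
    ultimately show ?thesis by (metis linorder_neqE_nat)
  qed
  ultimately show "S = S' \<and> B = B'" by blast
qed

lemma card_gap_sets_step:
  assumes "t \<in> T" "\<And>t'. t' \<in> T \<Longrightarrow> t' \<le> t" "2 * d \<le> t" "1 \<le> d"
  shows "card (gap_sets n d T) * 2 ^ d \<le> card (gap_sets n d (T - {t}))"
proof -
  have fin: "finite (gap_sets n d (T - {t}))"
    by (rule finite_subset[OF _ finite_spread_sets[of n d]]) (auto simp: gap_sets_def)
  have "refill t ` (gap_sets n d T \<times> Pow {..<d}) \<subseteq> gap_sets n d (T - {t})"
    using refill_gap[OF _ assms] by auto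
  then have "card (gap_sets n d T \<times> Pow {..<d}) \<le> card (gap_sets n d (T - {t}))"
    using card_inj_on_le[OF refill_inj[OF assms, of n]] fin by blast
  then show ?thesis by (simp add: card_cartesian_product card_Pow)
qed

text \<open>The induction adds elements in increasing order, so that
  \<open>card_gap_sets_step\<close> always removes the largest one.\<close>

lemma card_gap_sets:
  assumes "finite T" "\<And>t. t \<in> T \<Longrightarrow> 2 * d \<le> t" "1 \<le> d"
  shows "card (gap_sets n d T) * 2 ^ (d * card T) \<le> card (spread_sets n d)"
  using assms
proof (induction T rule: finite_linorder_max_induct)
  case empty
  have "gap_sets n d {} = spread_sets n d" by (auto simp: gap_sets_def)
  then show ?case by simp
next
  case (insert t T)
  have "t \<notin> T" using insert by blast
  have "card (gap_sets n d (insert t T)) * 2 ^ d \<le> card (gap_sets n d (insert t T - {t}))"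
    by (rule card_gap_sets_step) (use insert in \<open>auto intro: less_imp_le\<close>)
  then have "card (gap_sets n d (insert t T)) * 2 ^ d * 2 ^ (d * card T)
      \<le> card (gap_sets n d T) * 2 ^ (d * card T)"
    using \<open>t \<notin> T\<close> by simp
  also have "\<dots> \<le> card (spread_sets n d)" using insert by auto
  finally show ?case using insert \<open>t \<notin> T\<close> by (simp add: power_add mult_ac)
qed

section \<open>New values\<close>

text \<open>New values from the fourth on: three earlier values are what forces the gap in
  \<open>record_up\<close>.\<close>

definition records :: "nat \<Rightarrow> (nat \<Rightarrow> int) \<Rightarrow> nat set" where
  "records n f = {t \<in> {..n}. f t \<notin> f ` {..<t} \<and> 3 \<le> card (f ` {..<t})}"

text \<open>Each vertex adds at most one value. A new value that is no record comes after at most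
  two others, so the total is then at most 3.\<close>

lemma card_image_le_records: "card (f ` {..n}) \<le> 3 + card (records n f)"
proof (induction n)
  case 0
  then show ?case by simp
next
  case (Suc n)
  have fin: "finite (records n f)" by (simp add: records_def)
  have less: "{..<Suc n} = {..n}" by auto
  have im: "f ` {..Suc n} = insert (f (Suc n)) (f ` {..n})" by (simp add: atMost_Suc)
  have sub: "records n f \<subseteq> records (Suc n) f" by (auto simp: records_def)
  then have le: "card (records n f) \<le> card (records (Suc n) f)"
    by (intro card_mono) (auto simp: records_def)
  show ?case
  proof (cases "Suc n \<in> records (Suc n) f")
    case True
    have "insert (Suc n) (records n f) \<subseteq> records (Suc n) f" using True sub by blast
    then have "card (insert (Suc n) (records n f)) \<le> card (records (Suc n) f)"
      by (intro card_mono) (auto simp: records_def)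
    moreover have "Suc n \<notin> records n f" by (simp add: records_def)
    ultimately have "Suc (card (records n f)) \<le> card (records (Suc n) f)" using fin by simp
    moreover have "card (f ` {..Suc n}) \<le> Suc (card (f ` {..n}))"
      unfolding im by (rule card_insert_le_m1) auto
    ultimately show ?thesis using Suc by linarith
  next
    case False
    then consider "f (Suc n) \<in> f ` {..n}" | "card (f ` {..n}) < 3"
      by (auto simp: records_def less)
    then show ?thesis
    proof cases
      case 1
      then show ?thesis using Suc le im by (simp add: insert_absorb)
    next
      case 2
      have "card (f ` {..Suc n}) \<le> Suc (card (f ` {..n}))"
        unfolding im by (rule card_insert_le_m1) auto
      then show ?thesis using 2 by linarith
    qed
  qed
qed

text \<open>Discrete intermediate values: going back from \<open>t\<close> in unit steps,
  \<open>f\<close> could exceed \<open>f t\<close> only through the value \<open>f t + 1\<close>,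
  which first occurs at \<open>Suc t\<close>.\<close>

lemma hom_le_of_avoid:
  assumes f: "is_hom n d f" and t: "Suc t \<le> n" and new: "f (Suc t) \<notin> f ` {..t}"
    and up: "f (Suc t) = f t + 1" and j: "j \<le> t"
  shows "f j \<le> f t"
  using j
proof (induction rule: inc_induct)
  case base
  then show ?case by simp
next
  case (step i)
  have "\<bar>f (Suc i) - f i\<bar> = 1" using is_hom_step[OF f] step t by simp
  moreover have "f i \<noteq> f t + 1" using new up step by (metis atMost_iff imageI less_imp_le)
  ultimately show ?case using step by linarith
qed

text \<open>\<open>M = f (t - 1)\<close> is the largest earlier value. Hence an earlier neighbour of
  \<open>t\<close> cannot have value \<open>M + 2\<close> and has value \<open>M\<close>; likewise
  an earlier neighbour of \<open>t - 1\<close> has value \<open>M - 1\<close>. So \<open>f\<close>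
  alternates on the last \<open>2 * d + 2\<close> vertices before \<open>t\<close>, as far as they
  exist.\<close>

lemma record_up:
  assumes f: "is_hom n d f" and t: "t \<in> records n f" and up: "f t = f (t - 1) + 1"
  shows "2 * d + 2 \<le> t" "t \<in> turns n f" "\<And>u. u \<in> turns n f \<Longrightarrow> u < t \<Longrightarrow> u + 2 * d \<le> t"
proof -
  have "t \<noteq> 0" using t by (auto simp: records_def)
  then obtain s where s: "t = Suc s" by (cases t) auto
  define M where "M = f s"
  have tn: "Suc s \<le> n" and new: "f (Suc s) \<notin> f ` {..s}" and c: "3 \<le> card (f ` {..s})"
    and up': "f (Suc s) = f s + 1"
    using t up by (auto simp: records_def s lessThan_Suc_atMost)
  have le: "f j \<le> M" if "j \<le> s" for j
    unfolding M_def using hom_le_of_avoid[OF f tn new up' that] .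
  have oddv: "f j = M" if "j \<le> s" "t \<le> j + 2 * d + 1" "odd (t - j)" for j
    using is_homD[OF f, of j t] that tn le[of j] up' by (auto simp: s M_def)
  have evenv: "f j = M - 1" if "j \<le> s" "t \<le> j + 2 * d + 2" "even (t - j)" for j
  proof -
    have "j \<noteq> s" using that by (auto simp: s)
    moreover have "odd (s - j)" using that unfolding s by presburger
    ultimately have "\<bar>f s - f j\<bar> = 1" using that tn by (intro is_homD[OF f]) (auto simp: s)
    then show ?thesis using le[of j] that by (auto simp: M_def)
  qed
  show "2 * d + 2 \<le> t"
  proof (rule ccontr)
    \<comment> \<open>The alternating stretch would reach back to 0 and leave only two earlier
      values.\<close>
    assume "\<not> 2 * d + 2 \<le> t"
    then have "f j \<in> {M - 1, M}" if "j \<le> s" for j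
      using oddv[of j] evenv[of j] that by (cases "even (t - j)") auto
    then have "card (f ` {..s}) \<le> card {M - 1, M}" by (intro card_mono) auto
    then show False using c by (simp add: card_insert_if)
  qed
  then have "f (t - 2) = M - 1" by (intro evenv) (auto simp: s)
  then show "t \<in> turns n f" using up' tn \<open>2 * d + 2 \<le> t\<close> by (auto simp: turns_def s M_def)
  fix u assume u: "u \<in> turns n f" "u < t"
  show "u + 2 * d \<le> t"
  proof (rule ccontr)
    assume *: "\<not> u + 2 * d \<le> t"
    have u2: "2 \<le> u" "f u \<noteq> f (u - 2)" using u by (auto simp: turns_def)
    have b: "u \<le> s" "u - 2 \<le> s" "t \<le> u + 2 * d + 1" "t \<le> u - 2 + 2 * d + 1"
      using u * u2 by (auto simp: s)
    \<comment> \<open>Both \<open>u\<close> and \<open>u - 2\<close> lie in the alternating stretch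
      and have the same parity, so \<open>u\<close> cannot be a turn.\<close>
    have "even (t - u) \<longleftrightarrow> even (t - (u - 2))" using u u2 by presburger
    then have "f u = f (u - 2)" 
      using oddv[of u] oddv[of "u - 2"] evenv[of u] evenv[of "u - 2"] b by (cases "even (t - u)") auto
    then show False using u2 by simp
  qed
qed

text \<open>A downward record becomes an upward one for \<open>- f\<close>, which has the same
  records and turns.\<close>

lemma record_props:
  assumes f: "is_hom n d f" and t: "t \<in> records n f"
  shows "2 * d + 2 \<le> t" "t \<in> turns n f" "\<And>u. u \<in> turns n f \<Longrightarrow> u < t \<Longrightarrow> u + 2 * d \<le> t"
proof -
  have "t \<noteq> 0" "t \<le> n" using t by (auto simp: records_def)
  then have "\<bar>f t - f (t - 1)\<bar> = 1" using is_hom_step[OF f, of "t - 1"] by simp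
  then consider "f t = f (t - 1) + 1" | "- f t = - f (t - 1) + 1" by linarith
  then have "2 * d + 2 \<le> t \<and> t \<in> turns n f \<and> (\<forall>u. u \<in> turns n f \<longrightarrow> u < t \<longrightarrow> u + 2 * d \<le> t)"
  proof cases
    case 1
    then show ?thesis using record_up[OF f t] by blast
  next
    case 2
    have im: "(\<lambda>i. - f i) ` A = uminus ` f ` A" for A by (simp add: image_image)
    have "t \<in> records n (\<lambda>i. - f i)"
      using t unfolding records_def im by (simp add: card_image image_iff)
    moreover have "turns n (\<lambda>i. - f i) = turns n f" by (simp add: turns_def)
    ultimately show ?thesis using record_up[OF is_hom_uminus[OF f]] 2 by metis
  qed
  then show "2 * d + 2 \<le> t" "t \<in> turns n f" "\<And>u. u \<in> turns n f \<Longrightarrow> u < t \<Longrightarrow> u + 2 * d \<le> t"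
    by blast+
qed

section \<open>Large and small ranges\<close>

text \<open>A union bound over the sets \<open>T\<close> of \<open>r\<close> record times, with
  \<open>card_gap_sets\<close> applied to each \<open>T\<close>.\<close>

lemma card_large_range:
  assumes n: "n \<ge> 1" and d: "d \<ge> 1"
  shows "card {f \<in> Hom_P n d. 3 + r \<le> card (Rng n f)} * 2 ^ (d * r) \<le> (n choose r) * card (Hom_P n d)"
proof -
  \<comment> \<open>The bound \<open>2 * d \<le> t\<close> is what \<open>card_gap_sets\<close> asks
    of \<open>T\<close>; records satisfy it by \<open>record_props\<close>.\<close>
  define \<T> where "\<T> = {T. T \<subseteq> {1..n} \<and> card T = r \<and> (\<forall>t\<in>T. 2 * d \<le> t)}"
  have fin: "finite \<T>" by (rule finite_subset[of _ "Pow {1..n}"]) (auto simp: \<T>_def)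
  have "\<T> \<subseteq> {T. T \<subseteq> {1..n} \<and> card T = r}" by (auto simp: \<T>_def)
  then have "card \<T> \<le> card {T. T \<subseteq> {1..n} \<and> card T = r}" by (intro card_mono) auto
  then have card\<T>: "card \<T> \<le> n choose r" using n_subsets[of "{1..n}" r] by simp
  have "{f \<in> Hom_P n d. 3 + r \<le> card (Rng n f)} \<subseteq>
      (\<Union>T\<in>\<T>. {f \<in> Hom_P n d. turns n f \<in> gap_sets n d T})"
  proof
    fix f assume f': "f \<in> {f \<in> Hom_P n d. 3 + r \<le> card (Rng n f)}"
    then have f: "f \<in> Hom_P n d" "is_hom n d f" by (auto simp: Hom_P_iff)
    have "r \<le> card (records n f)"
      using f' card_image_le_records[of f n] by (simp add: Rng_def atLeast0AtMost)
    then obtain T where T: "T \<subseteq> records n f" "card T = r" by (rule obtain_subset_with_card_n)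
    have "\<And>t. t \<in> T \<Longrightarrow> 2 * d + 2 \<le> t" "T \<subseteq> turns n f" "T \<subseteq> {..n}"
      using record_props[OF f(2)] T by (auto simp: records_def)
    then have "T \<in> \<T>" using T by (force simp: \<T>_def)
    moreover have "turns n f \<in> gap_sets n d T"
      using turns_spread[OF f(2)] \<open>T \<subseteq> turns n f\<close> record_props(3)[OF f(2)] T
      unfolding gap_sets_def by blast
    ultimately show "f \<in> (\<Union>T\<in>\<T>. {f \<in> Hom_P n d. turns n f \<in> gap_sets n d T})"
      using f by blast
  qed
  then have "card {f \<in> Hom_P n d. 3 + r \<le> card (Rng n f)} \<le>
      card (\<Union>T\<in>\<T>. {f \<in> Hom_P n d. turns n f \<in> gap_sets n d T})"
    using fin finite_Hom_P by (intro card_mono) auto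
  also have "\<dots> \<le> (\<Sum>T\<in>\<T>. card {f \<in> Hom_P n d. turns n f \<in> gap_sets n d T})"
    by (rule card_UN_le[OF fin])
  also have "\<dots> = (\<Sum>T\<in>\<T>. 2 * card (gap_sets n d T))"
    by (intro sum.cong refl card_Hom_P_turns[OF n]) (auto simp: gap_sets_def)
  finally have "card {f \<in> Hom_P n d. 3 + r \<le> card (Rng n f)} * 2 ^ (d * r)
      \<le> (\<Sum>T\<in>\<T>. 2 * card (gap_sets n d T)) * 2 ^ (d * r)" by simp
  also have "\<dots> = (\<Sum>T\<in>\<T>. 2 * (card (gap_sets n d T) * 2 ^ (d * r)))"
    by (simp only: sum_distrib_right mult.assoc)
  also have "\<dots> \<le> (\<Sum>T\<in>\<T>. card (Hom_P n d))"
  proof (rule sum_mono)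
    fix T assume "T \<in> \<T>"
    then have "finite T" "card T = r" "\<And>t. t \<in> T \<Longrightarrow> 2 * d \<le> t"
      by (auto simp: \<T>_def intro: finite_subset)
    then show "2 * (card (gap_sets n d T) * 2 ^ (d * r)) \<le> card (Hom_P n d)"
      using card_gap_sets[of T d n] d card_Hom_P[OF n, of d] by simp
  qed
  also have "\<dots> \<le> (n choose r) * card (Hom_P n d)" using card\<T> by simp
  finally show ?thesis .
qed

text \<open>At a turn three consecutive values are distinct.\<close>

lemma turns_small_range:
  assumes f: "is_hom n d f" and c: "card (Rng n f) < 3"
  shows "turns n f = {}"
proof (rule ccontr)
  assume "turns n f \<noteq> {}"
  then obtain t where "t \<in> turns n f" by blast
  then have t: "2 \<le> t" "t \<le> n" "f t \<noteq> f (t - 2)" by (auto simp: turns_def)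
  then obtain s where s: "t = Suc (Suc s)" by (metis add_2_eq_Suc le_Suc_ex)
  have "\<bar>f (Suc (Suc s)) - f (Suc s)\<bar> = 1" "\<bar>f (Suc s) - f s\<bar> = 1"
    using is_hom_step[OF f] t s by auto
  then have "card {f s, f (Suc s), f (Suc (Suc s))} = 3" using t s by auto
  moreover have "card {f s, f (Suc s), f (Suc (Suc s))} \<le> card (Rng n f)"
    unfolding Rng_def using t s by (intro card_mono) auto
  ultimately show False using c by simp
qed

lemma card_small_range:
  assumes n: "n \<ge> 1"
  shows "card {f \<in> Hom_P n d. card (Rng n f) < 3} * 2 ^ (n div 2) \<le> card (Hom_P n d)"
proof -
  have "card {f \<in> Hom_P n d. card (Rng n f) < 3} \<le> card {f \<in> Hom_P n d. turns n f \<in> {{}}}"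
  proof (rule card_mono)
    show "finite {f \<in> Hom_P n d. turns n f \<in> {{}}}" using finite_Hom_P by simp
    show "{f \<in> Hom_P n d. card (Rng n f) < 3} \<subseteq> {f \<in> Hom_P n d. turns n f \<in> {{}}}"
      using turns_small_range by (auto simp: Hom_P_iff)
  qed
  also have "\<dots> = 2" using card_Hom_P_turns[OF n, of "{{}}" d] by (simp add: spread_sets_def)
  finally have "card {f \<in> Hom_P n d. card (Rng n f) < 3} \<le> 2" .
  moreover have "2 ^ (n div 2) \<le> card (spread_sets n d)"
  proof -
    \<comment> \<open>Times of equal parity never conflict, so every subset of the even times is a
      spread set.\<close>
    define E where "E = (\<lambda>k. 2 * k) ` {1..n div 2}"
    have "card E = n div 2" unfolding E_def by (simp add: card_image inj_on_def)
    then have "card (Pow E) = 2 ^ (n div 2)" by (simp add: card_Pow E_def)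
    moreover have "Pow E \<subseteq> spread_sets n d"
      by (force simp: E_def spread_sets_def)
    ultimately show ?thesis using card_mono[OF finite_spread_sets] by metis
  qed
  ultimately have "card {f \<in> Hom_P n d. card (Rng n f) < 3} * 2 ^ (n div 2) \<le> 2 * card (spread_sets n d)"
    by (rule mult_le_mono)
  then show ?thesis using card_Hom_P[OF n] by simp
qed

section \<open>Probabilities and the limit\<close>

lemma prob_unif_Hom_P:
  "measure_pmf.prob (unif_Hom_P n d) {f. P f} = card {f \<in> Hom_P n d. P f} / card (Hom_P n d)"
  unfolding unif_Hom_P_def
  by (simp add: measure_pmf_of_set[OF Hom_P_nonempty finite_Hom_P] Int_def)

lemma card_Hom_P_pos: "card (Hom_P n d) > 0"
  using finite_Hom_P Hom_P_nonempty by (simp add: card_gt_0_iff)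

lemma prob_large_range:
  assumes "n \<ge> 1" "d \<ge> 1"
  shows "measure_pmf.prob (unif_Hom_P n d) {f. card (Rng n f) \<ge> 3 + r}
    \<le> real (n choose r) * 2 powr (- (real d * real r))"
proof -
  have "real (card {f \<in> Hom_P n d. 3 + r \<le> card (Rng n f)} * 2 ^ (d * r))
      \<le> real ((n choose r) * card (Hom_P n d))"
    using card_large_range[OF assms] by (simp only: of_nat_le_iff)
  moreover have "2 powr (- (real d * real r)) = 1 / 2 ^ (d * r)"
    by (simp add: powr_minus powr_realpow[symmetric] field_simps)
  ultimately show ?thesis
    using card_Hom_P_pos[of n d] unfolding prob_unif_Hom_P \<open>2 powr _ = _\<close>
    by (simp add: divide_le_eq le_divide_eq)
qed

lemma prob_small_range:
  assumes "n \<ge> 1"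
  shows "measure_pmf.prob (unif_Hom_P n d) {f. card (Rng n f) < 3} \<le> 2 powr (1 - real n / 2)"
proof -
  have "real (card {f \<in> Hom_P n d. card (Rng n f) < 3} * 2 ^ (n div 2)) \<le> real (card (Hom_P n d))"
    using card_small_range[OF assms] by (simp only: of_nat_le_iff)
  then have "measure_pmf.prob (unif_Hom_P n d) {f. card (Rng n f) < 3} \<le> 1 / 2 ^ (n div 2)"
    using card_Hom_P_pos[of n d] unfolding prob_unif_Hom_P by (simp add: field_simps)
  also have "\<dots> = 2 powr (- real (n div 2))"
    by (simp add: powr_minus powr_realpow field_simps)
  also have "\<dots> \<le> 2 powr (1 - real n / 2)"
  proof -
    \<comment> \<open>Rounding \<open>n / 2\<close> down loses at most 1/2, which the 1 in the
      exponent covers.\<close>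
    have "n \<le> 2 * (n div 2) + 1" by linarith
    then have "real n \<le> 2 * real (n div 2) + 1" by linarith
    then show ?thesis by (intro powr_mono) auto
  qed
  finally show ?thesis .
qed

text \<open>The complement splits into the large-range event for \<open>r = 1\<close> and the
  small-range event; the factor \<open>n\<close> of the former enters the exponent as
  \<open>log 2 n\<close>.\<close>

lemma prob_range_3:
  assumes "n \<ge> 1" "d \<ge> 1"
  shows "1 - (2 powr (- (real d - log 2 (real n))) + 2 powr (1 - real n / 2))
    \<le> measure_pmf.prob (unif_Hom_P n d) {f. card (Rng n f) = 3}"
proof -
  let ?p = "\<lambda>A. measure_pmf.prob (unif_Hom_P n d) A"
  let ?A = "{f. card (Rng n f) \<ge> 3 + 1}" and ?B = "{f. card (Rng n f) < 3}"
  have "1 - ?p {f. card (Rng n f) = 3} = ?p (- {f. card (Rng n f) = 3})"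
    using measure_pmf.prob_compl[of "{f. card (Rng n f) = 3}" "unif_Hom_P n d"]
    by (simp add: Compl_eq_Diff_UNIV)
  also have "- {f. card (Rng n f) = 3} = ?A \<union> ?B" by auto
  also have "?p (?A \<union> ?B) \<le> ?p ?A + ?p ?B" by (rule measure_Un_le) auto
  also have "?p ?A \<le> real n * 2 powr (- real d)"
    using prob_large_range[OF assms, of 1] by simp
  also have "?p ?B \<le> 2 powr (1 - real n / 2)" by (rule prob_small_range[OF assms(1)])
  also have "real n * 2 powr (- real d) = 2 powr (- (real d - log 2 (real n)))"
    using assms(1) by (simp add: powr_add[symmetric] powr_diff powr_minus field_simps)
  finally show ?thesis by simp
qed

theorem theorem2p1:
  "(\<forall>n d r :: nat. n \<ge> 1 \<longrightarrow> d \<ge> 1 \<longrightarrow> r \<ge> 1 \<longrightarrow>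
      measure_pmf.prob (unif_Hom_P n d) {f. card (Rng n f) \<ge> 3 + r}
        \<le> real (n choose r) * 2 powr (- (real d * real r)) \<and>
      measure_pmf.prob (unif_Hom_P n d) {f. card (Rng n f) < 3}
        \<le> 2 powr (1 - real n / 2)) \<and>
   (\<forall>d :: nat \<Rightarrow> nat. (\<forall>n\<ge>1. d n \<ge> 1) \<longrightarrow>
      filterlim (\<lambda>n. real (d n) - log 2 (real n)) at_top sequentially \<longrightarrow>
      (\<lambda>n. measure_pmf.prob (unif_Hom_P n (d n)) {f. card (Rng n f) = 3}) \<longlonglongrightarrow> 1)"
proof (intro conjI allI impI)
  fix n d r :: nat assume "n \<ge> 1" "d \<ge> 1" "r \<ge> 1"
  then show "measure_pmf.prob (unif_Hom_P n d) {f. card (Rng n f) \<ge> 3 + r}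
      \<le> real (n choose r) * 2 powr (- (real d * real r))"
    by (intro prob_large_range)
next
  fix n d r :: nat assume "n \<ge> 1"
  then show "measure_pmf.prob (unif_Hom_P n d) {f. card (Rng n f) < 3} \<le> 2 powr (1 - real n / 2)"
    by (rule prob_small_range)
next
  fix d :: "nat \<Rightarrow> nat"
  assume d: "\<forall>n\<ge>1. d n \<ge> 1"
    and lim: "filterlim (\<lambda>n. real (d n) - log 2 (real n)) at_top sequentially"
  have exp_lim: "((\<lambda>x::real. 2 powr (- x)) \<longlongrightarrow> 0) at_top" by real_asymp
  have "(\<lambda>n. 2 powr (- (real (d n) - log 2 (real n)))) \<longlonglongrightarrow> 0"
    using filterlim_compose[OF exp_lim lim] .
  moreover have "(\<lambda>n. 2 powr (1 - real n / 2)) \<longlonglongrightarrow> 0" by real_asymp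
  ultimately have low: "(\<lambda>n. 1 - (2 powr (- (real (d n) - log 2 (real n))) + 2 powr (1 - real n / 2)))
      \<longlonglongrightarrow> 1 - (0 + 0)"
    by (intro tendsto_intros)
  show "(\<lambda>n. measure_pmf.prob (unif_Hom_P n (d n)) {f. card (Rng n f) = 3}) \<longlonglongrightarrow> 1"
  proof (rule tendsto_sandwich)
    show "\<forall>\<^sub>F n in sequentially. 1 - (2 powr (- (real (d n) - log 2 (real n))) + 2 powr (1 - real n / 2))
        \<le> measure_pmf.prob (unif_Hom_P n (d n)) {f. card (Rng n f) = 3}"
      \<comment> \<open>Both \<open>n \<ge> 1\<close> and \<open>d n \<ge> 1\<close>, which
        \<open>prob_range_3\<close> requires, hold from 1 on.\<close>
      using eventually_ge_at_top[of 1] by eventually_elim (use prob_range_3 d in blast)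
    show "\<forall>\<^sub>F n in sequentially. measure_pmf.prob (unif_Hom_P n (d n)) {f. card (Rng n f) = 3} \<le> 1"
      by simp
  qed (use low in simp_all)
qed

end
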